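(* If $T$ is a topologically C*-transitive operator on $B_0(H)$, then $T$ is generalized numerically transitive on $B_0(H)$.
   Context: $H$ is a complex separable Hilbert space with an orthonormal basis $\{e_j\}_{j\in\mathbb Z}$, and $B_0(H)$ is the C*-algebra of compact operators on $H$ with the operator norm. Operators on $B_0(H)$ are bounded linear maps $T\in\mathcal B(B_0(H))$. Let $S(B_0(H))$ be the unit sphere of $B_0(H)$. $T$ is topologically C*-transitive on $B_0(H)$ (with respect to $\varphi(A,B)=B^*A$) if for every nonempty open $W\subseteq S(B_0(H))\times S(B_0(H))$ and nonempty open $O\subseteq B_0(H)$ there exist $n\in\mathbb N$ and $(A,B)\in W$ with $\varphi(T^nA,B)=B^*T^n(A)\in O$. $T$ is generalized numerically transitive on $B_0(H)$ if for every nonempty open $\widetilde O\subseteq B_0(H)\times B_0(H)$ and nonempty open $O\subseteq B_0(H)$ there exist $n\in\mathbb N$ and $(A,B)\in\widetilde O$ with $A\,T^n(B)\in O$. *)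

theory Defs
  imports "HOL-Analysis.Analysis"
begin

text \<open>A complex normed space extends a real one (which carries norm and topology) by a
  compatible complex scalar multiplication. A complex Hilbert space has, in addition, an inner
  product, linear in the first argument and inducing the norm, and is complete.\<close>

class complex_normed_space = real_normed_vector +
  fixes scaleC :: "complex \<Rightarrow> 'a \<Rightarrow> 'a" (infixr "*\<^sub>C" 75)
  assumes scaleC_add_right: "a *\<^sub>C (x + y) = a *\<^sub>C x + a *\<^sub>C y"
    and scaleC_add_left: "(a + b) *\<^sub>C x = a *\<^sub>C x + b *\<^sub>C x"
    and scaleC_scaleC: "a *\<^sub>C (b *\<^sub>C x) = (a * b) *\<^sub>C x"
    and scaleC_of_real: "complex_of_real r *\<^sub>C x = r *\<^sub>R x"
    and norm_scaleC: "norm (a *\<^sub>C x) = cmod a * norm x"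

class complex_hilbert_space = complex_normed_space + complete_space +
  fixes cinner :: "'a \<Rightarrow> 'a \<Rightarrow> complex"
  assumes cinner_commute: "cinner x y = cnj (cinner y x)"
    and cinner_add_left: "cinner (x + y) z = cinner x z + cinner y z"
    and cinner_scaleC_left: "cinner (a *\<^sub>C x) y = a * cinner x y"
    and cinner_self: "cinner x x = complex_of_real ((norm x)\<^sup>2)"

lemma scaleC_one: "1 *\<^sub>C x = (x :: 'a :: complex_normed_space)"
  using scaleC_of_real[of 1 x] by simp

lemma vector_space_scaleC:
  "vector_space (scaleC :: complex \<Rightarrow> 'a \<Rightarrow> 'a :: complex_normed_space)"
  by unfold_locales (simp_all add: scaleC_add_right scaleC_add_left scaleC_scaleC scaleC_one)

lemma bounded_linear_scaleC:
  "bounded_linear (\<lambda>x. a *\<^sub>C (x :: 'a :: complex_normed_space))"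
proof (rule bounded_linear_intro[where K = "cmod a"])
  fix x y :: 'a and r :: real
  show "a *\<^sub>C (x + y) = a *\<^sub>C x + a *\<^sub>C y"
    by (rule scaleC_add_right)
  show "a *\<^sub>C (r *\<^sub>R x) = r *\<^sub>R (a *\<^sub>C x)"
    by (metis scaleC_of_real scaleC_scaleC mult.commute)
  show "norm (a *\<^sub>C x) \<le> norm x * cmod a"
    by (simp add: norm_scaleC mult.commute)
qed

instantiation blinfun :: (real_normed_vector, complex_normed_space) complex_normed_space
begin

lift_definition scaleC_blinfun ::
  "complex \<Rightarrow> ('a \<Rightarrow>\<^sub>L 'b) \<Rightarrow> ('a \<Rightarrow>\<^sub>L 'b)" is "\<lambda>a f x. a *\<^sub>C f x"
  by (rule bounded_linear_compose[OF bounded_linear_scaleC])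

instance
proof
  fix a b :: complex and r :: real and f g :: "'a \<Rightarrow>\<^sub>L 'b"
  show "a *\<^sub>C (f + g) = a *\<^sub>C f + a *\<^sub>C g"
    by transfer (simp add: scaleC_add_right)
  show "(a + b) *\<^sub>C f = a *\<^sub>C f + b *\<^sub>C f"
    by transfer (simp add: scaleC_add_left)
  show "a *\<^sub>C (b *\<^sub>C f) = (a * b) *\<^sub>C f"
    by transfer (simp add: scaleC_scaleC)
  show "complex_of_real r *\<^sub>C f = r *\<^sub>R f"
    by transfer (simp add: scaleC_of_real)
  have le: "norm (c *\<^sub>C h) \<le> cmod c * norm h" for c and h :: "'a \<Rightarrow>\<^sub>L 'b"
  proof (rule norm_blinfun_bound)
    fix x
    have "norm (c *\<^sub>C h x) \<le> cmod c * (norm h * norm x)"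
      unfolding norm_scaleC by (intro mult_left_mono norm_blinfun) simp
    then show "norm ((c *\<^sub>C h) x) \<le> cmod c * norm h * norm x"
      by (simp add: scaleC_blinfun.rep_eq mult.assoc)
  qed simp
  show "norm (a *\<^sub>C f) = cmod a * norm f"
  proof (cases "a = 0")
    case True
    then show ?thesis using le[of a f] by simp
  next
    case False
    have "f = inverse a *\<^sub>C (a *\<^sub>C f)"
      using False by transfer (simp add: scaleC_scaleC scaleC_one)
    then have "norm f \<le> cmod (inverse a) * norm (a *\<^sub>C f)"
      using le[of "inverse a" "a *\<^sub>C f"] by simp
    then have "cmod a * norm f \<le> norm (a *\<^sub>C f)"
      using False by (simp add: norm_divide field_simps)
    then show ?thesis using le[of a f] by simp
  qed
qed

end

definition orthonormal_basis :: "('i \<Rightarrow> 'a :: complex_hilbert_space) \<Rightarrow> bool" where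
  "orthonormal_basis e \<longleftrightarrow>
     (\<forall>i j. cinner (e i) (e j) = (if i = j then 1 else 0)) \<and>
     closure (module.span scaleC (range e)) = UNIV"

text \<open>Elements of \<open>'a \<Rightarrow>\<^sub>L 'a\<close> are a priori only real-linear, so complex linearity is required explicitly.
  The norm of this type is the operator norm.\<close>

definition compact_ops :: "('a :: complex_hilbert_space \<Rightarrow>\<^sub>L 'a) set" where
  "compact_ops = {A. Vector_Spaces.linear scaleC scaleC (blinfun_apply A) \<and>
                     compact (closure (blinfun_apply A ` cball 0 1))}"

definition hilbert_adjoint ::
  "('a :: complex_hilbert_space \<Rightarrow>\<^sub>L 'a) \<Rightarrow> ('a \<Rightarrow>\<^sub>L 'a)" where
  "hilbert_adjoint A = (THE A' :: 'a \<Rightarrow>\<^sub>L 'a. \<forall>x y. cinner (A x) y = cinner x (A' y))"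

text \<open>Bounded complex-linear self-maps of a subspace; values outside \<open>S\<close> are irrelevant.\<close>

definition bounded_clinear_on :: "'b :: complex_normed_space set \<Rightarrow> ('b \<Rightarrow> 'b) \<Rightarrow> bool" where
  "bounded_clinear_on S T \<longleftrightarrow>
     T ` S \<subseteq> S \<and>
     (\<forall>x\<in>S. \<forall>y\<in>S. T (x + y) = T x + T y) \<and>
     (\<forall>c. \<forall>x\<in>S. T (c *\<^sub>C x) = c *\<^sub>C T x) \<and>
     (\<exists>K. \<forall>x\<in>S. norm (T x) \<le> K * norm x)"

definition sphere_compact_ops :: "('a :: complex_hilbert_space \<Rightarrow>\<^sub>L 'a) set" where
  "sphere_compact_ops = {A \<in> compact_ops. norm A = 1}"

definition topologically_cstar_transitive ::
  "(('a :: complex_hilbert_space \<Rightarrow>\<^sub>L 'a) \<Rightarrow> ('a \<Rightarrow>\<^sub>L 'a)) \<Rightarrow> bool" where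
  "topologically_cstar_transitive T \<longleftrightarrow>
     (\<forall>W U. openin (top_of_set (sphere_compact_ops \<times> sphere_compact_ops)) W \<and> W \<noteq> {} \<and>
            openin (top_of_set compact_ops) U \<and> U \<noteq> {} \<longrightarrow>
        (\<exists>n::nat. \<exists>(A, B)\<in>W. hilbert_adjoint B o\<^sub>L (T ^^ n) A \<in> U))"

definition generalized_numerically_transitive ::
  "(('a :: complex_hilbert_space \<Rightarrow>\<^sub>L 'a) \<Rightarrow> ('a \<Rightarrow>\<^sub>L 'a)) \<Rightarrow> bool" where
  "generalized_numerically_transitive T \<longleftrightarrow>
     (\<forall>V U. openin (top_of_set (compact_ops \<times> compact_ops)) V \<and> V \<noteq> {} \<and>
            openin (top_of_set compact_ops) U \<and> U \<noteq> {} \<longrightarrow>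
        (\<exists>n::nat. \<exists>(A, B)\<in>V. A o\<^sub>L (T ^^ n) B \<in> U))"

end

theory Submission
  imports Defs
begin

text \<open>Rescaling and taking adjoints turn the pairing \<open>B\<^sup>* T\<^sup>n(A)\<close> on the unit spheres into
  \<open>A T\<^sup>n(B)\<close> on all of the compact operators: given an open set of pairs, choose in it a pair
  \<open>(A\<^sub>0, B\<^sub>0)\<close> of nonzero operators with norms \<open>a\<close> and \<open>b\<close>, and pull the set back along
  \<open>(A, B) \<mapsto> (a B\<^sup>*, b A)\<close>. Since \<open>(a B\<^sup>*) T\<^sup>n(b A) = a b B\<^sup>* T\<^sup>n(A)\<close>, transitivity is applied with the
  target set divided by \<open>a b\<close>. This needs that the adjoint exists and is an isometric
  involution that preserves compactness.\<close>

section \<open>The Riesz representation\<close>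

text \<open>The operator type only carries real linearity, so Riesz representation and uniqueness
  are run with this real inner product, which induces the same norm. Complex identities are
  recovered afterwards by testing against multiples by \<i>.\<close>

definition rinner :: "'a::complex_hilbert_space \<Rightarrow> 'a \<Rightarrow> real" where
  "rinner x y = Re (cinner x y)"

lemma rinner_commute: "rinner x y = rinner y x"
  unfolding rinner_def by (subst cinner_commute) simp

lemma rinner_add_left: "rinner (x + y) z = rinner x z + rinner y z"
  by (simp add: rinner_def cinner_add_left)

lemma rinner_add_right: "rinner x (y + z) = rinner x y + rinner x z"
  by (metis rinner_commute rinner_add_left)

lemma rinner_scaleR_left: "rinner (r *\<^sub>R x) y = r * rinner x y"
  by (simp add: rinner_def cinner_scaleC_left flip: scaleC_of_real)

lemma rinner_scaleR_right: "rinner x (r *\<^sub>R y) = r * rinner x y"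
  by (metis rinner_commute rinner_scaleR_left)

lemma rinner_diff_right: "rinner x (y - z) = rinner x y - rinner x z"
  using rinner_add_right[of x "y - z" z] by simp

lemma rinner_diff_left: "rinner (x - y) z = rinner x z - rinner y z"
  by (metis rinner_commute rinner_diff_right)

lemma rinner_self: "rinner x x = (norm x)\<^sup>2"
  by (simp add: rinner_def cinner_self)

lemmas rinner_simps = rinner_add_left rinner_add_right rinner_scaleR_left rinner_scaleR_right
  rinner_diff_left rinner_diff_right

lemma norm_add_squared: "(norm (x + y))\<^sup>2 = (norm x)\<^sup>2 + 2 * rinner x y + (norm y)\<^sup>2"
  for x y :: "'a::complex_hilbert_space"
  using rinner_commute[of x y] by (simp add: rinner_simps flip: rinner_self)

lemma norm_diff_squared: "(norm (x - y))\<^sup>2 = (norm x)\<^sup>2 - 2 * rinner x y + (norm y)\<^sup>2"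
  for x y :: "'a::complex_hilbert_space"
  using rinner_commute[of x y] by (simp add: rinner_simps flip: rinner_self)

text \<open>Cauchy-Schwarz is read off from the triangle inequality, which the norm already
  satisfies, by expanding both squares.\<close>

lemma rinner_le_norm: "rinner x y \<le> norm x * norm y"
proof -
  have "(norm (x + y))\<^sup>2 \<le> (norm x + norm y)\<^sup>2"
    by (simp add: norm_triangle_ineq power_mono)
  then show ?thesis
    by (simp add: norm_add_squared power2_sum)
qed

lemma cinner_scaleC_right: "cinner x (a *\<^sub>C y) = cnj a * cinner x y"
  by (metis cinner_commute cinner_scaleC_left complex_cnj_cnj complex_cnj_mult)

lemma cinner_scaleR_left: "cinner (r *\<^sub>R x) y = complex_of_real r * cinner x y"
  by (metis cinner_scaleC_left scaleC_of_real)

lemma cinner_scaleR_right: "cinner x (r *\<^sub>R y) = complex_of_real r * cinner x y"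
  by (metis cinner_scaleC_right complex_cnj_complex_of_real scaleC_of_real)

lemma Im_cinner: "Im (cinner x y) = - rinner (\<i> *\<^sub>C x) y"
  by (simp add: rinner_def cinner_scaleC_left)

lemma eq_if_rinner_eq:
  assumes "\<And>x. rinner x y = rinner x z"
  shows "y = z"
  using rinner_self[of "y - z"] assms[of "y - z"] by (simp add: rinner_diff_right)

text \<open>If \<open>f\<close> is the pairing with \<open>z\<close>, then \<open>J x\<close> is the
  squared distance from \<open>x\<close> to \<open>z\<close> minus a constant. Conversely,
  completeness yields a minimizer of \<open>J\<close>, and the vanishing of the first variation
  there is the representation.\<close>

lemma riesz_representation:
  fixes f :: "'a::complex_hilbert_space \<Rightarrow> real"
  assumes "bounded_linear f"
  obtains z where "\<And>x. f x = rinner x z"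
proof -
  interpret f: bounded_linear f by fact
  \<comment> \<open>The representing vector is the minimizer of \<open>J\<close>.\<close>
  define J where "J x = (norm x)\<^sup>2 - 2 * f x" for x
  define m where "m = Inf (range J)"
  obtain K where K: "\<And>x. norm (f x) \<le> norm x * K"
    using f.bounded by blast
  have "- K\<^sup>2 \<le> J x" for x
  proof -
    have "f x \<le> norm x * K" using K[of x] by simp
    moreover have "0 \<le> (norm x - K)\<^sup>2" by simp
    ultimately show ?thesis by (simp add: J_def power2_diff)
  qed
  then have bdd: "bdd_below (range J)"
    by (meson bdd_belowI2)
  have m_le: "m \<le> J x" for x
    unfolding m_def by (rule cInf_lower[OF _ bdd]) simp
  have "\<exists>x. J x < m + inverse (Suc n)" for n
    using cInf_lessD[of "range J" "m + inverse (Suc n)"] by (auto simp: m_def)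
  then obtain X where X: "\<And>n. J (X n) < m + inverse (Suc n)"
    by metis
  \<comment> \<open>Parallelogram law: since \<open>J\<close> at the midpoint is at least
    \<open>m\<close>, two near-minimizers must be close to each other.\<close>
  have dist: "(norm (x - y))\<^sup>2 \<le> 2 * (J x - m) + 2 * (J y - m)" for x y
  proof -
    have "J ((1/2) *\<^sub>R (x + y)) = (norm (x + y))\<^sup>2 / 4 - (f x + f y)"
      by (simp add: J_def f.scaleR f.add power_divide add_divide_distrib del: scaleR_add_right)
    then have "(norm (x - y))\<^sup>2 = 2 * J x + 2 * J y - 4 * J ((1/2) *\<^sub>R (x + y))"
      by (simp add: J_def norm_add_squared norm_diff_squared field_simps)
    then show ?thesis using m_le[of "(1/2) *\<^sub>R (x + y)"] by simp
  qed
  have "Cauchy X"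
  proof (rule metric_CauchyI)
    fix e :: real assume "0 < e"
    \<comment> \<open>Two excesses below a quarter of the squared \<open>e\<close>, each doubled in
      \<open>dist\<close>, add up to less than the squared \<open>e\<close>.\<close>
    then obtain N where N: "inverse (Suc N) < e\<^sup>2 / 4"
      using reals_Archimedean[of "e\<^sup>2 / 4"] by auto
    have small: "J (X n) - m < e\<^sup>2 / 4" if "n \<ge> N" for n
    proof -
      have "inverse (real (Suc n)) \<le> inverse (Suc N)" using that by simp
      then show ?thesis using X[of n] N by linarith
    qed
    have "dist (X i) (X j) < e" if "i \<ge> N" "j \<ge> N" for i j
    proof -
      have "(norm (X i - X j))\<^sup>2 < e\<^sup>2"
        using dist[of "X i" "X j"] small[OF that(1)] small[OF that(2)] by argo
      then show ?thesis
        using \<open>0 < e\<close> by (simp add: dist_norm power_less_imp_less_base)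
    qed
    then show "\<exists>N. \<forall>i\<ge>N. \<forall>j\<ge>N. dist (X i) (X j) < e" by blast
  qed
  then obtain z where z: "X \<longlonglongrightarrow> z"
    using Cauchy_convergent convergent_def by blast
  have "(\<lambda>n. J (X n)) \<longlonglongrightarrow> J z"
    unfolding J_def by (intro tendsto_intros f.tendsto z)
  moreover have "(\<lambda>n. m + inverse (Suc n)) \<longlonglongrightarrow> m + 0"
    by (intro tendsto_intros LIMSEQ_inverse_real_of_nat)
  ultimately have "J z \<le> m + 0"
    by (rule LIMSEQ_le) (meson X less_imp_le)
  then have min: "J z \<le> J x" for x
    using m_le[of x] by simp
  have "f x = rinner x z" for x
  proof -
    define d where "d = rinner x z - f x"
    \<comment> \<open>The right-hand side is the increment of \<open>J\<close> from \<open>z\<close>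
      to \<open>z + t *\<^sub>R x\<close>.\<close>
    have quad: "0 \<le> 2 * t * d + t\<^sup>2 * (norm x)\<^sup>2" for t
      using min[of "z + t *\<^sub>R x"]
      by (simp add: J_def norm_add_squared f.add f.scaleR rinner_simps d_def power_mult_distrib
          rinner_commute[of z x] algebra_simps)
    \<comment> \<open>The quadratic in \<open>t\<close> is tested at \<open>- d / s\<close>. The
      added 1 keeps \<open>s\<close> positive even for \<open>x = 0\<close>.\<close>
    define s where "s = (norm x)\<^sup>2 + 1"
    have "s > 0" by (simp add: s_def add_nonneg_pos)
    have "0 \<le> s\<^sup>2 * (2 * (- d / s) * d + (- d / s)\<^sup>2 * (norm x)\<^sup>2)"
      by (intro mult_nonneg_nonneg quad) simp
    also have "\<dots> = - (d\<^sup>2 * ((norm x)\<^sup>2 + 2))"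
      using \<open>s > 0\<close> by (simp add: field_simps power2_eq_square) (simp add: s_def power2_eq_square algebra_simps)
    finally have "d\<^sup>2 * ((norm x)\<^sup>2 + 2) \<le> 0" by simp
    moreover have "(norm x)\<^sup>2 + 2 > 0" by (simp add: add_nonneg_pos)
    ultimately have "d = 0" by (simp add: mult_le_0_iff)
    then show ?thesis by (simp add: d_def)
  qed
  then show ?thesis by (rule that)
qed

section \<open>Adjoints of bounded complex-linear operators\<close>

text \<open>Additivity is built into the type, so homogeneity is all that separates this from
  complex linearity.\<close>

definition clinear :: "('a::complex_normed_space \<Rightarrow>\<^sub>L 'a) \<Rightarrow> bool" where
  "clinear A \<longleftrightarrow> (\<forall>c x. A (c *\<^sub>C x) = c *\<^sub>C A x)"

lemma linear_scaleC_iff_clinear: "Vector_Spaces.linear scaleC scaleC (blinfun_apply A) \<longleftrightarrow> clinear A"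
  by (simp add: Vector_Spaces.linear_iff vector_space_scaleC clinear_def blinfun.add_right)

lemma clinear_diff:
  assumes "clinear A" "clinear B"
  shows "clinear (A - B)"
proof -
  interpret vector_space "scaleC :: complex \<Rightarrow> 'a \<Rightarrow> 'a" by (rule vector_space_scaleC)
  show ?thesis
    using assms by (simp add: clinear_def blinfun.diff_left scale_right_diff_distrib)
qed

text \<open>The imaginary parts agree because the real identity also holds at \<i> times
  \<open>x\<close>, which complex linearity moves through \<open>A\<close>.\<close>

lemma cinner_eq_if_rinner_eq:
  assumes "clinear A" "\<And>x. rinner (A x) y = rinner x z"
  shows "cinner (A x) y = cinner x z"
proof (rule complex_eqI)
  show "Re (cinner (A x) y) = Re (cinner x z)"
    using assms(2)[of x] by (simp add: rinner_def)
  show "Im (cinner (A x) y) = Im (cinner x z)"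
    using assms(2)[of "\<i> *\<^sub>C x"] assms(1) by (simp add: Im_cinner clinear_def)
qed

text \<open>Riesz gives a representing vector for each \<open>y\<close> separately; its uniqueness
  makes the dependence on \<open>y\<close> linear.\<close>

lemma adjoint_exists:
  fixes A :: "'a::complex_hilbert_space \<Rightarrow>\<^sub>L 'a"
  assumes "clinear A"
  shows "\<exists>A' :: 'a \<Rightarrow>\<^sub>L 'a. \<forall>x y. cinner (A x) y = cinner x (A' y)"
proof -
  have "\<exists>z. \<forall>x. rinner (A x) y = rinner x z" for y
  proof -
    have "bounded_linear (\<lambda>x. rinner (A x) y)"
    proof (rule bounded_linear_intro[where K = "norm A * norm y"])
      fix x
      \<comment> \<open>\<open>rinner_le_norm\<close> is one-sided, so the absolute value needs it
        for \<open>A x\<close> and for its negative.\<close>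
      have "\<bar>rinner (A x) y\<bar> \<le> norm (A x) * norm y"
        using rinner_le_norm[of "A x" y] rinner_le_norm[of "- A x" y]
          rinner_scaleR_left[of "- 1" "A x" y] by simp
      also have "\<dots> \<le> norm A * norm x * norm y"
        by (intro mult_right_mono norm_blinfun) simp
      finally show "norm (rinner (A x) y) \<le> norm x * (norm A * norm y)"
        by (simp add: mult_ac)
    qed (simp_all add: blinfun.add_right blinfun.scaleR_right rinner_simps)
    then show ?thesis by (metis riesz_representation)
  qed
  then obtain g where g: "\<And>x y. rinner (A x) y = rinner x (g y)"
    by metis
  have "bounded_linear g"
  proof (rule bounded_linear_intro[where K = "norm A"])
    fix x y :: 'a and r :: real
    show "g (x + y) = g x + g y"
      by (rule eq_if_rinner_eq) (simp add: rinner_simps flip: g)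
    show "g (r *\<^sub>R x) = r *\<^sub>R g x"
      by (rule eq_if_rinner_eq) (simp add: rinner_simps flip: g)
    \<comment> \<open>Testing the identity \<open>g\<close> at the vector \<open>g x\<close> itself
      allows one factor \<open>norm (g x)\<close> to be cancelled.\<close>
    have "norm (g x) * norm (g x) = rinner (A (g x)) x"
      by (simp add: g rinner_self power2_eq_square)
    also have "\<dots> \<le> norm (A (g x)) * norm x"
      by (rule rinner_le_norm)
    also have "\<dots> \<le> norm A * norm (g x) * norm x"
      by (intro mult_right_mono norm_blinfun) simp
    finally have "norm (g x) * norm (g x) \<le> norm (g x) * (norm x * norm A)"
      by (simp add: mult_ac)
    then show "norm (g x) \<le> norm x * norm A"
      by (cases "norm (g x) = 0") (auto simp: mult_le_cancel_left)
  qed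
  then have "blinfun_apply (Blinfun g) = g"
    by (rule bounded_linear_Blinfun_apply)
  then show ?thesis
    using cinner_eq_if_rinner_eq[OF assms] g by metis
qed

text \<open>The definite description picks out a candidate only once uniqueness is shown; afterwards
  adjoints can be computed by verifying a candidate.\<close>

lemma hilbert_adjoint_eqI:
  fixes A A' :: "'a::complex_hilbert_space \<Rightarrow>\<^sub>L 'a"
  assumes "\<And>x y. cinner (A x) y = cinner x (A' y)"
  shows "hilbert_adjoint A = A'"
  unfolding hilbert_adjoint_def
proof (rule the_equality)
  fix B :: "'a \<Rightarrow>\<^sub>L 'a" assume B: "\<forall>x y. cinner (A x) y = cinner x (B y)"
  show "B = A'"
  proof (rule blinfun_eqI, rule eq_if_rinner_eq)
    show "rinner x (B y) = rinner x (A' y)" for x y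
      using B assms by (metis rinner_def)
  qed
qed (use assms in blast)

lemma cinner_hilbert_adjoint:
  assumes "clinear A"
  shows "cinner (A x) y = cinner x (hilbert_adjoint A y)"
  using adjoint_exists[OF assms] hilbert_adjoint_eqI by metis

lemma rinner_hilbert_adjoint:
  assumes "clinear A"
  shows "rinner (A x) y = rinner x (hilbert_adjoint A y)"
  by (simp add: rinner_def cinner_hilbert_adjoint[OF assms])

lemma cinner_hilbert_adjoint_left:
  assumes "clinear A"
  shows "cinner (hilbert_adjoint A x) y = cinner x (A y)"
  by (metis assms cinner_commute cinner_hilbert_adjoint)

lemma hilbert_adjoint_involution:
  assumes "clinear A"
  shows "hilbert_adjoint (hilbert_adjoint A) = A"
  by (rule hilbert_adjoint_eqI) (rule cinner_hilbert_adjoint_left[OF assms])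

lemma clinear_hilbert_adjoint:
  assumes "clinear A"
  shows "clinear (hilbert_adjoint A)"
  unfolding clinear_def
proof (intro allI, rule eq_if_rinner_eq)
  show "rinner x (hilbert_adjoint A (c *\<^sub>C y)) = rinner x (c *\<^sub>C hilbert_adjoint A y)" for c x y
    by (simp add: rinner_def cinner_scaleC_right flip: cinner_hilbert_adjoint[OF assms])
qed

lemma hilbert_adjoint_diff:
  assumes "clinear A" "clinear B"
  shows "hilbert_adjoint (A - B) = hilbert_adjoint A - hilbert_adjoint B"
proof (rule blinfun_eqI, rule eq_if_rinner_eq)
  show "rinner x (hilbert_adjoint (A - B) y) = rinner x ((hilbert_adjoint A - hilbert_adjoint B) y)"
    for x y
    using assms clinear_diff[OF assms]
    by (simp add: rinner_simps blinfun.diff_left flip: rinner_hilbert_adjoint)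
qed

lemma hilbert_adjoint_scaleR:
  assumes "clinear A"
  shows "hilbert_adjoint (r *\<^sub>R A) = r *\<^sub>R hilbert_adjoint A"
proof (rule hilbert_adjoint_eqI)
  show "cinner ((r *\<^sub>R A) x) y = cinner x ((r *\<^sub>R hilbert_adjoint A) y)" for x y
    by (simp add: blinfun.scaleR_left cinner_scaleR_left cinner_scaleR_right
        cinner_hilbert_adjoint[OF assms])
qed

text \<open>Move the adjoint across in the squared norm, then apply Cauchy-Schwarz. This controls
  the adjoint by \<open>A\<close> composed with it, for the norm bound and for compactness
  alike.\<close>

lemma norm_hilbert_adjoint_apply_squared:
  assumes "clinear A"
  shows "(norm (hilbert_adjoint A y))\<^sup>2 \<le> norm (A (hilbert_adjoint A y)) * norm y"
  by (metis assms rinner_hilbert_adjoint rinner_le_norm rinner_self)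

lemma norm_hilbert_adjoint_le:
  assumes "clinear A"
  shows "norm (hilbert_adjoint A) \<le> norm A"
proof (rule norm_blinfun_bound)
  fix y
  let ?z = "hilbert_adjoint A y"
  have "norm ?z * norm ?z \<le> norm (A ?z) * norm y"
    using norm_hilbert_adjoint_apply_squared[OF assms] by (simp add: power2_eq_square)
  also have "\<dots> \<le> norm A * norm ?z * norm y"
    by (intro mult_right_mono norm_blinfun) simp
  finally have "norm ?z * norm ?z \<le> norm ?z * (norm A * norm y)"
    by (simp add: mult_ac)
  then show "norm ?z \<le> norm A * norm y"
    by (cases "norm ?z = 0") (auto simp: mult_le_cancel_left)
qed simp

lemma norm_hilbert_adjoint:
  assumes "clinear A"
  shows "norm (hilbert_adjoint A) = norm A"
  using norm_hilbert_adjoint_le[OF assms]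
    norm_hilbert_adjoint_le[OF clinear_hilbert_adjoint[OF assms]]
  by (simp add: hilbert_adjoint_involution[OF assms])

section \<open>Compact operators\<close>

lemma compact_ops_iff:
  "A \<in> compact_ops \<longleftrightarrow> clinear A \<and> compact (closure (blinfun_apply A ` cball 0 1))"
  by (simp add: compact_ops_def linear_scaleC_iff_clinear)

lemma compact_ops_clinear: "A \<in> compact_ops \<Longrightarrow> clinear A"
  by (simp add: compact_ops_iff)

lemma compact_closure_subset:
  fixes S :: "'a::t2_space set"
  assumes "compact K" "S \<subseteq> K"
  shows "compact (closure S)"
proof -
  have "K \<inter> closure S = closure S"
    using assms by (simp add: Int_absorb1 closure_minimal compact_imp_closed)
  then show ?thesis
    using compact_Int_closed[OF assms(1) closed_closure[of S]] by simp
qed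

text \<open>A bounded set lies in a multiple of the unit ball, and scaling preserves
  compactness.\<close>

lemma compact_closure_image_bounded:
  assumes "A \<in> compact_ops" "bounded S"
  shows "compact (closure (blinfun_apply A ` S))"
proof -
  obtain r where r: "r > 0" "\<And>x. x \<in> S \<Longrightarrow> norm x \<le> r"
    using assms(2) bounded_pos by blast
  show ?thesis
  proof (rule compact_closure_subset)
    show "compact ((*\<^sub>R) r ` closure (blinfun_apply A ` cball 0 1))"
      using assms(1) by (simp add: compact_ops_iff compact_scaling)
    show "blinfun_apply A ` S \<subseteq> (*\<^sub>R) r ` closure (blinfun_apply A ` cball 0 1)"
    proof clarify
      fix x assume "x \<in> S"
      then have "inverse r *\<^sub>R x \<in> cball 0 1"
        using r by (simp add: field_simps)
      then have "A (inverse r *\<^sub>R x) \<in> closure (blinfun_apply A ` cball 0 1)"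
        by (intro subsetD[OF closure_subset] imageI)
      moreover have "A x = r *\<^sub>R A (inverse r *\<^sub>R x)"
        using \<open>r > 0\<close> by (simp add: blinfun.scaleR_right)
      ultimately show "A x \<in> (*\<^sub>R) r ` closure (blinfun_apply A ` cball 0 1)"
        by (rule rev_image_eqI)
    qed
  qed
qed

lemma compact_ops_scaleR:
  assumes "A \<in> compact_ops"
  shows "r *\<^sub>R A \<in> compact_ops"
proof -
  have "blinfun_apply (r *\<^sub>R A) ` cball 0 1 = blinfun_apply A ` ((*\<^sub>R) r ` cball 0 1)"
    by (simp add: image_image blinfun.scaleR_left blinfun.scaleR_right)
  moreover have "bounded ((*\<^sub>R) r ` cball (0::'a) 1)"
    by (simp add: bounded_scaling)
  moreover have "clinear (r *\<^sub>R A)"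
    using compact_ops_clinear[OF assms]
    by (simp add: clinear_def blinfun.scaleR_left linear_cmul[OF bounded_linear.linear[OF bounded_linear_scaleC]])
  ultimately show ?thesis
    by (simp only: compact_ops_iff compact_closure_image_bounded[OF assms] simp_thms)
qed

text \<open>On the unit ball, \<open>A\<^sup>* y\<close> is a uniformly continuous function of \<open>A A\<^sup>* y\<close>, which ranges over a
  relatively compact set.\<close>

lemma compact_ops_hilbert_adjoint:
  assumes "A \<in> compact_ops"
  shows "hilbert_adjoint A \<in> compact_ops"
proof -
  have A: "clinear A" by (rule compact_ops_clinear[OF assms])
  let ?A' = "hilbert_adjoint A"
  let ?D = "cball (0::'a) 1"
  define F where "F y = A (?A' y)" for y
  \<comment> \<open>The factor 2 is the diameter of the unit ball, bounding
    \<open>norm (y - z)\<close>.\<close>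
  have est: "(dist (?A' y) (?A' z))\<^sup>2 \<le> 2 * dist (F y) (F z)" if "y \<in> ?D" "z \<in> ?D" for y z
  proof -
    have "norm (y - z) \<le> 2"
      using that norm_triangle_ineq4[of y z] by simp
    then have "(norm (?A' (y - z)))\<^sup>2 \<le> norm (A (?A' (y - z))) * 2"
      by (meson norm_hilbert_adjoint_apply_squared[OF A] mult_left_mono norm_ge_zero order_trans)
    then show ?thesis
      by (simp add: F_def dist_norm blinfun.diff_right)
  qed
  \<comment> \<open>The chosen preimage is arbitrary, but by \<open>est\<close> equal values of
    \<open>F\<close> on the ball force equal values of the adjoint.\<close>
  define g where "g w = ?A' (SOME y. y \<in> ?D \<and> F y = w)" for w
  have g: "g (F y) = ?A' y" if "y \<in> ?D" for y
  proof -
    define z where "z = (SOME z. z \<in> ?D \<and> F z = F y)"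
    have "z \<in> ?D \<and> F z = F y"
      unfolding z_def by (rule someI[of _ y]) (use that in simp)
    then have "(dist (?A' z) (?A' y))\<^sup>2 \<le> 0"
      using est[of z y] that by simp
    then show ?thesis
      by (simp add: g_def z_def)
  qed
  have "uniformly_continuous_on (F ` ?D) g"
    unfolding uniformly_continuous_on_def
  proof (intro allI impI)
    fix e :: real assume "0 < e"
    have "dist (g w') (g w) < e" if "w \<in> F ` ?D" "w' \<in> F ` ?D" "dist w' w < e\<^sup>2 / 2" for w w'
    proof -
      obtain y z where yz: "y \<in> ?D" "z \<in> ?D" "w = F y" "w' = F z"
        using \<open>w \<in> F ` ?D\<close> \<open>w' \<in> F ` ?D\<close> by blast
      have "(dist (?A' z) (?A' y))\<^sup>2 < e\<^sup>2"
        using est[of z y] yz that(3) by simp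
      then have "dist (?A' z) (?A' y) < e"
        using \<open>0 < e\<close> by (simp add: power_less_imp_less_base)
      then show ?thesis using yz g by simp
    qed
    moreover have "e\<^sup>2 / 2 > 0" using \<open>0 < e\<close> by simp
    ultimately show "\<exists>d>0. \<forall>x\<in>F ` ?D. \<forall>x'\<in>F ` ?D. dist x' x < d \<longrightarrow> dist (g x') (g x) < e"
      by blast
  qed
  \<comment> \<open>Extending to the closure makes the domain compact, so the image under
    \<open>h\<close> is a compact set containing the image of the ball under the adjoint.\<close>
  then obtain h where h: "uniformly_continuous_on (closure (F ` ?D)) h"
    "\<And>w. w \<in> F ` ?D \<Longrightarrow> g w = h w"
    by (rule uniformly_continuous_on_extension_on_closure) blast
  have "F ` ?D = blinfun_apply A ` (blinfun_apply ?A' ` ?D)"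
    by (simp add: F_def image_image)
  moreover have "bounded (blinfun_apply ?A' ` ?D)"
    by (intro bounded_linear_image bounded_cball blinfun.bounded_linear_right)
  ultimately have "compact (closure (F ` ?D))"
    by (simp only: compact_closure_image_bounded[OF assms])
  then have "compact (h ` closure (F ` ?D))"
    by (intro compact_continuous_image uniformly_continuous_imp_continuous h(1))
  moreover have "blinfun_apply ?A' ` ?D \<subseteq> h ` closure (F ` ?D)"
  proof clarify
    fix y assume "y \<in> ?D"
    then have "?A' y = h (F y)" "F y \<in> closure (F ` ?D)"
      using g[of y] h(2)[of "F y"] closure_subset[of "F ` ?D"] by auto
    then show "?A' y \<in> h ` closure (F ` ?D)" by blast
  qed
  ultimately show ?thesis
    unfolding compact_ops_iff using clinear_hilbert_adjoint[OF A] compact_closure_subset by blast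
qed

lemma continuous_on_hilbert_adjoint: "continuous_on compact_ops hilbert_adjoint"
proof (rule continuous_onI)
  fix A :: "'a \<Rightarrow>\<^sub>L 'a" and e :: real assume A: "A \<in> compact_ops" and "0 < e"
  have "dist (hilbert_adjoint B) (hilbert_adjoint A) \<le> e"
    if "B \<in> compact_ops" "dist B A < e" for B
  proof -
    have "clinear (B - A)"
      using that A by (intro clinear_diff compact_ops_clinear)
    then show ?thesis
      using that A by (simp add: dist_norm compact_ops_clinear norm_hilbert_adjoint
          flip: hilbert_adjoint_diff)
  qed
  then show "\<exists>d>0. \<forall>B\<in>compact_ops. dist B A < d \<longrightarrow>
      dist (hilbert_adjoint B) (hilbert_adjoint A) \<le> e"
    using \<open>0 < e\<close> by blast
qed

text \<open>Normalizing to the unit sphere requires nonzero operators. A vanishing component is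
  replaced by a small multiple of \<open>E\<close>, a nonzero one is left alone, and openness keeps
  the pair in \<open>V\<close>.\<close>

lemma openin_compact_ops_prod_nonzero:
  fixes A B E :: "'a::complex_hilbert_space \<Rightarrow>\<^sub>L 'a"
  assumes V: "openin (top_of_set (compact_ops \<times> compact_ops)) V" "(A, B) \<in> V"
    and E: "E \<in> compact_ops" "E \<noteq> 0"
  obtains A' B' where "(A', B') \<in> V" "A' \<noteq> 0" "B' \<noteq> 0"
proof -
  obtain G where G: "open G" "V = (compact_ops \<times> compact_ops) \<inter> G"
    using V(1) openin_open by blast
  define p where "p C t = (if C = 0 then t *\<^sub>R E else C)" for C :: "'a \<Rightarrow>\<^sub>L 'a" and t :: real
  have p: "(p C \<longlongrightarrow> C) (at 0)" for C
  proof (cases "C = 0")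
    case True
    have "((\<lambda>t. t *\<^sub>R E) \<longlongrightarrow> 0 *\<^sub>R E) (at 0)"
      by (intro tendsto_intros)
    then show ?thesis using True by (simp add: p_def[abs_def])
  qed (simp add: p_def[abs_def])
  have "((\<lambda>t. (p A t, p B t)) \<longlongrightarrow> (A, B)) (at 0)"
    by (intro tendsto_Pair p)
  then have "eventually (\<lambda>t. (p A t, p B t) \<in> G) (at 0)"
    by (rule topological_tendstoD) (use G V(2) in auto)
  moreover have "eventually (\<lambda>t::real. t \<noteq> 0) (at 0)"
    by (simp add: eventually_at_filter)
  ultimately have "eventually (\<lambda>t::real. (p A t, p B t) \<in> G \<and> t \<noteq> 0) (at 0)"
    by (rule eventually_conj)
  then obtain t where t: "(p A t, p B t) \<in> G" "t \<noteq> 0"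
    using eventually_happens trivial_limit_at by blast
  have mem: "p C t \<in> compact_ops" if "C \<in> compact_ops" for C
    using that E(1) by (simp add: p_def compact_ops_scaleR)
  show ?thesis
  proof (rule that)
    show "(p A t, p B t) \<in> V"
      using t G V(2) mem by auto
    show "p A t \<noteq> 0" "p B t \<noteq> 0"
      using t(2) E(2) by (auto simp: p_def)
  qed
qed

section \<open>Iterates of \<open>T\<close> and the passage from the spheres to all pairs\<close>

lemma bounded_clinear_on_funpow:
  assumes "bounded_clinear_on S T" "A \<in> S"
  shows "(T ^^ n) A \<in> S" and "(T ^^ n) (r *\<^sub>R A) = r *\<^sub>R (T ^^ n) A"
proof -
  \<comment> \<open>Nothing is known about \<open>T\<close> outside \<open>S\<close>, so homogeneity
    of the iterates relies on each of them staying in \<open>S\<close>.\<close>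
  show mem: "(T ^^ n) A \<in> S" for n
    by (induction n) (use assms in \<open>auto simp: bounded_clinear_on_def\<close>)
  show "(T ^^ n) (r *\<^sub>R A) = r *\<^sub>R (T ^^ n) A"
  proof (induction n)
    case (Suc n)
    have "T (complex_of_real r *\<^sub>C (T ^^ n) A) = complex_of_real r *\<^sub>C T ((T ^^ n) A)"
      using assms(1) mem[of n] by (simp add: bounded_clinear_on_def)
    then show ?case
      by (simp add: Suc scaleC_of_real)
  qed simp
qed

theorem proposition4p5:
  fixes e :: "int \<Rightarrow> 'a :: complex_hilbert_space"
    and T :: "('a \<Rightarrow>\<^sub>L 'a) \<Rightarrow> ('a \<Rightarrow>\<^sub>L 'a)"
  assumes "orthonormal_basis e"
    and "bounded_clinear_on compact_ops T"
    and "topologically_cstar_transitive T"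
  shows "generalized_numerically_transitive T"
  unfolding generalized_numerically_transitive_def
proof (intro allI impI, elim conjE)
  let ?K = "compact_ops :: ('a \<Rightarrow>\<^sub>L 'a) set"
  let ?S = "sphere_compact_ops :: ('a \<Rightarrow>\<^sub>L 'a) set"
  fix V :: "(('a \<Rightarrow>\<^sub>L 'a) \<times> ('a \<Rightarrow>\<^sub>L 'a)) set" and U :: "('a \<Rightarrow>\<^sub>L 'a) set"
  assume V: "openin (top_of_set (?K \<times> ?K)) V" "V \<noteq> {}"
    and U: "openin (top_of_set ?K) U" "U \<noteq> {}"
  have sub: "V \<subseteq> ?K \<times> ?K" "U \<subseteq> ?K"
    using V(1) U(1) by (auto dest: openin_imp_subset)
  obtain A1 B1 where AB1: "(A1, B1) \<in> V" using V(2) by auto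
  show "\<exists>n. \<exists>(A, B)\<in>V. A o\<^sub>L (T ^^ n) B \<in> U"
  proof (cases "?K \<subseteq> {0}")
    \<comment> \<open>If zero is the only compact operator, the spheres are empty and transitivity
      says nothing; the zeroth iterate already works.\<close>
    case True
    then have "A1 = 0" "U = {0}" using AB1 sub U(2) by auto
    then have "A1 o\<^sub>L (T ^^ 0) B1 \<in> U" by simp
    then show ?thesis using AB1 by blast
  next
    case False
    then obtain E where "E \<in> ?K" "E \<noteq> 0" by blast
    then obtain A0 B0 where AB0: "(A0, B0) \<in> V" "A0 \<noteq> 0" "B0 \<noteq> 0"
      using openin_compact_ops_prod_nonzero[OF V(1) AB1] by blast
    then have K0: "A0 \<in> ?K" "B0 \<in> ?K" using sub by auto
    define a b where "a = norm A0" and "b = norm B0"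
    have pos: "a > 0" "b > 0" using AB0 by (auto simp: a_def b_def)
    define \<Phi> :: "('a \<Rightarrow>\<^sub>L 'a) \<times> ('a \<Rightarrow>\<^sub>L 'a) \<Rightarrow> ('a \<Rightarrow>\<^sub>L 'a) \<times> ('a \<Rightarrow>\<^sub>L 'a)"
      where "\<Phi> = (\<lambda>(A, B). (a *\<^sub>R hilbert_adjoint B, b *\<^sub>R A))"
    define W where "W = (?S \<times> ?S) \<inter> \<Phi> -` V"
    define U' where "U' = ?K \<inter> (\<lambda>X. (a * b) *\<^sub>R X) -` U"
    have "openin (top_of_set (?S \<times> ?S)) W"
      unfolding W_def
    proof (rule continuous_openin_preimage[OF _ _ V(1)])
      \<comment> \<open>Continuity of the adjoint is available on \<open>compact_ops\<close> only,
        hence the composition on restricted domains.\<close>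
      have "continuous_on (?S \<times> ?S) (\<lambda>p. hilbert_adjoint (snd p))"
        by (rule continuous_on_compose2[OF continuous_on_hilbert_adjoint])
          (auto simp: sphere_compact_ops_def intro: continuous_intros)
      then show "continuous_on (?S \<times> ?S) \<Phi>"
        unfolding \<Phi>_def case_prod_beta by (intro continuous_intros)
      show "\<Phi> \<in> ?S \<times> ?S \<rightarrow> ?K \<times> ?K"
        by (auto simp: \<Phi>_def sphere_compact_ops_def compact_ops_scaleR compact_ops_hilbert_adjoint)
    qed
    moreover have "W \<noteq> {}"
    \<comment> \<open>The preimage of \<open>(A0, B0)\<close> is found by solving for each component
      with the involution. Taking \<open>a\<close> and \<open>b\<close> to be the norms puts it on
      the spheres.\<close>
    proof -
      have adj: "hilbert_adjoint A0 \<in> ?K" "norm (hilbert_adjoint A0) = a"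
        using K0 by (auto simp: compact_ops_hilbert_adjoint norm_hilbert_adjoint
            compact_ops_clinear a_def)
      have "hilbert_adjoint (inverse a *\<^sub>R hilbert_adjoint A0) = inverse a *\<^sub>R A0"
        using K0(1) adj(1) by (simp add: hilbert_adjoint_scaleR hilbert_adjoint_involution
            compact_ops_clinear)
      then have "\<Phi> (inverse b *\<^sub>R B0, inverse a *\<^sub>R hilbert_adjoint A0) = (A0, B0)"
        using pos by (simp add: \<Phi>_def)
      moreover have "inverse b *\<^sub>R B0 \<in> ?S" "inverse a *\<^sub>R hilbert_adjoint A0 \<in> ?S"
        using K0 adj pos by (auto simp: sphere_compact_ops_def compact_ops_scaleR b_def)
      ultimately have "(inverse b *\<^sub>R B0, inverse a *\<^sub>R hilbert_adjoint A0) \<in> W"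
        using AB0 by (simp add: W_def)
      then show ?thesis by blast
    qed
    moreover have "openin (top_of_set ?K) U'"
      unfolding U'_def
      by (rule continuous_openin_preimage[OF _ _ U(1)])
        (auto intro!: continuous_intros compact_ops_scaleR)
    moreover have "U' \<noteq> {}"
    proof -
      obtain X where "X \<in> U" using U(2) by blast
      moreover have "(a * b) *\<^sub>R inverse (a * b) *\<^sub>R X = X"
        using pos by (simp del: inverse_mult_distrib)
      ultimately have "inverse (a * b) *\<^sub>R X \<in> U'"
        unfolding U'_def using sub compact_ops_scaleR by (metis IntI subsetD vimageI)
      then show ?thesis by blast
    qed
    ultimately obtain n A B where n: "(A, B) \<in> W" "hilbert_adjoint B o\<^sub>L (T ^^ n) A \<in> U'"
      using assms(3) unfolding topologically_cstar_transitive_def by blast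
    have "A \<in> ?K" using n(1) by (simp add: W_def sphere_compact_ops_def)
    \<comment> \<open>The scalar \<open>b\<close> passes through the iterate because
      \<open>A\<close> is compact, so both scalars collect into the factor built into
      \<open>U'\<close>.\<close>
    then have "(a *\<^sub>R hilbert_adjoint B) o\<^sub>L (T ^^ n) (b *\<^sub>R A)
        = (a * b) *\<^sub>R (hilbert_adjoint B o\<^sub>L (T ^^ n) A)"
      by (intro blinfun_eqI) (simp add: bounded_clinear_on_funpow(2)[OF assms(2)]
          blinfun.scaleR_left blinfun.scaleR_right)
    then have "(a *\<^sub>R hilbert_adjoint B) o\<^sub>L (T ^^ n) (b *\<^sub>R A) \<in> U"
      using n(2) by (simp add: U'_def)
    moreover have "(a *\<^sub>R hilbert_adjoint B, b *\<^sub>R A) \<in> V"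
      using n(1) by (simp add: W_def \<Phi>_def)
    ultimately show ?thesis by blast
  qed
qed

end
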